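(* Let $\mathbb{F}$ be a field, let $(\mathcal{V}, \langle \cdot , \cdot \rangle)$ be a pre-euclidean space over $\mathbb{F}$, let $f : \mathcal{V} \to \mathcal{V}$ be a linear operator, and let $\mathcal{B}=\{e_j\}_{j\in J}$ be a fixed basis of $\mathcal{V}$. Let $\Gamma(f,\mathcal{B})=(V,E)$ be the graph associated to $f$ relative to $\mathcal{B}$, let $\sim$ be the relation of being connected on $V=\mathcal{B}$, and let $I\subset J$ index a set of representatives of the classes, so that $V/\!\sim\,=\{[e_i]\}_{i\in I}$ with $[e_i]\neq[e_k]$ for $i\neq k$ in $I$. For $i\in I$ put $\mathcal{B}_{[i]}:=\{e_j : e_j\in[e_i]\}$ and let $U_i$ be the linear subspace of $\mathcal{V}$ with basis $\mathcal{B}_{[i]}$ (a basis inherited from $\mathcal{B}$). Then $$\mathcal{V}=\bigoplus_{i\in I}U_i \quad\text{is an orthogonal direct sum.}$$ Moreover, there are linear operators $f_i:\mathcal{V}\to\mathcal{V}$, $i\in I$, such that $f=\sum_{i\in I}f_i$ and, for each $i\in I$, $$f_i|_{U_i}=f|_{U_i},\qquad f_i(U_i)\subset U_i,\qquad f_i\Bigl(\bigoplus_{j\in I,\, j\neq i}U_j\Bigr)=\{0\}.$$ Further, for each $i\in I$, $U_i$ is $f_i$-indecomposable with respect to $\mathcal{B}_{[i]}$.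
   Context: Vector spaces are over an arbitrary field $\mathbb{F}$ and of arbitrary (possibly infinite) dimension. A pre-euclidean space is a pair $(\mathcal{V}, \langle\cdot,\cdot\rangle)$ where $\mathcal{V}$ is an $\mathbb{F}$-vector space and $\langle\cdot,\cdot\rangle:\mathcal{V}\times\mathcal{V}\to\mathbb{F}$ is a bilinear form (no symmetry or non-degeneracy is assumed). A subspace $U$ carries the restricted form. Orthogonal direct sum: $\mathcal{V}=\bigoplus_{i\in I}U_i$ is an orthogonal direct sum if it is a direct sum of linear subspaces with $\langle u,w\rangle=0$ for all $u\in U_i$, $w\in U_j$ whenever $i\neq j$. For two subspaces this is written $U_1\perp U_2$. Associated graph: $\Gamma(f,\mathcal{B})=(V,E)$ is the directed graph with vertex set $V=\mathcal{B}$ and with $(e_i,e_j)\in E$ if and only if $\langle e_i,e_j\rangle\neq 0$, or $\langle e_j,e_i\rangle\neq 0$, or the coefficient of $e_j$ in the expansion of $f(e_i)$ in the basis $\mathcal{B}$ is non-zero. Connected vertices: an undirected path from $v$ to $w$ is a finite sequence of vertices $(v_{1},\dots,v_{n})$ with $v_1=v$, $v_n=w$ and, for each $1\le r\le n-1$, $(v_r,v_{r+1})\in E$ or $(v_{r+1},v_r)\in E$. One writes $v\sim w$ if $v=w$ or there is an undirected path from $v$ to $w$; this is an equivalence relation, and $[v]$ denotes the class of $v$. The sum $\sum_{i\in I}f_i$ is understood pointwise: on each vector only finitely many terms are non-zero. A linear subspace admits a basis inherited from a given basis if some subset of that basis is a basis of the subspace. For a subspace $U$ with basis $\mathcal{C}$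 and a linear operator $g$ with $g(U)\subset U$: $U$ is $g$-decomposable with respect to $\mathcal{C}$ if $U=U_1'\perp U_2'$ with $U_1',U_2'$ non-zero linear subspaces, each admitting a basis inherited from $\mathcal{C}$, and $g(U_1')\subset U_1'$, $g(U_2')\subset U_2'$. Otherwise $U$ is $g$-indecomposable with respect to $\mathcal{C}$. *)

theory Defs
  imports "Graph_Theory.Digraph_Component" "Graph_Theory.Vertex_Walk"
begin

section \<open>Sums of subspaces\<close>

text \<open>\<open>u\<close> is a finitely supported family, extended by \<open>0\<close> outside \<open>I\<close> so that it is determined
  by its members in \<open>I\<close>.\<close>

definition decomposes_as ::
  "'i set \<Rightarrow> ('i \<Rightarrow> 'v::ab_group_add set) \<Rightarrow> 'v \<Rightarrow> ('i \<Rightarrow> 'v) \<Rightarrow> bool" where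
  "decomposes_as I U v u \<longleftrightarrow>
     (\<forall>i\<in>I. u i \<in> U i) \<and> (\<forall>i. i \<notin> I \<longrightarrow> u i = 0) \<and>
     finite {i. u i \<noteq> 0} \<and> v = (\<Sum>i | u i \<noteq> 0. u i)"

definition subspace_sum :: "'i set \<Rightarrow> ('i \<Rightarrow> 'v::ab_group_add set) \<Rightarrow> 'v set" where
  "subspace_sum I U = {v. \<exists>u. decomposes_as I U v u}"

definition is_pointwise_sum ::
  "('v \<Rightarrow> 'v::ab_group_add) \<Rightarrow> 'i set \<Rightarrow> ('i \<Rightarrow> 'v \<Rightarrow> 'v) \<Rightarrow> bool" where
  "is_pointwise_sum f I g \<longleftrightarrow>
     (\<forall>v. finite {i \<in> I. g i v \<noteq> 0} \<and> f v = (\<Sum>i | i \<in> I \<and> g i v \<noteq> 0. g i v))"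


section \<open>Connected vertices of a directed graph\<close>

text \<open>\<^const>\<open>mk_symmetric\<close> contains both orientations of every arc, so its vertex walks are the
  undirected paths of the given digraph.\<close>

definition undirected_path :: "'a pair_pre_digraph \<Rightarrow> 'a \<Rightarrow> 'a list \<Rightarrow> 'a \<Rightarrow> bool" where
  "undirected_path G v p w \<longleftrightarrow> vwalk p (mk_symmetric G) \<and> hd p = v \<and> last p = w"

definition connected_rel :: "'a pair_pre_digraph \<Rightarrow> 'a rel" where
  "connected_rel G =
     {(v, w). v \<in> pverts G \<and> w \<in> pverts G \<and> (v = w \<or> (\<exists>p. undirected_path G v p w))}"

definition connected_class :: "'a pair_pre_digraph \<Rightarrow> 'a \<Rightarrow> 'a set" where
  "connected_class G v = connected_rel G `` {v}"


section \<open>Pre-euclidean spaces\<close>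

locale pre_euclidean_space = vector_space scale
  for scale :: "'a::field \<Rightarrow> 'b::ab_group_add \<Rightarrow> 'b" +
  fixes form :: "'b \<Rightarrow> 'b \<Rightarrow> 'a"
  assumes linear_form_left: "\<And>w. Vector_Spaces.linear scale (*) (\<lambda>v. form v w)"
    and linear_form_right: "\<And>v. Vector_Spaces.linear scale (*) (\<lambda>w. form v w)"
begin

definition is_basis :: "'b set \<Rightarrow> 'b set \<Rightarrow> bool" where
  "is_basis C U \<longleftrightarrow> independent C \<and> span C = U"

definition admits_inherited_basis :: "'b set \<Rightarrow> 'b set \<Rightarrow> bool" where
  "admits_inherited_basis C U \<longleftrightarrow> (\<exists>C'\<subseteq>C. is_basis C' U)"

definition direct_sum :: "'b set \<Rightarrow> 'i set \<Rightarrow> ('i \<Rightarrow> 'b set) \<Rightarrow> bool" where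
  "direct_sum W I U \<longleftrightarrow>
     (\<forall>i\<in>I. subspace (U i)) \<and> W = subspace_sum I U \<and>
     (\<forall>v\<in>W. \<exists>!u. decomposes_as I U v u)"

definition orthogonal_direct_sum :: "'b set \<Rightarrow> 'i set \<Rightarrow> ('i \<Rightarrow> 'b set) \<Rightarrow> bool" where
  "orthogonal_direct_sum W I U \<longleftrightarrow>
     direct_sum W I U \<and>
     (\<forall>i\<in>I. \<forall>j\<in>I. i \<noteq> j \<longrightarrow> (\<forall>u\<in>U i. \<forall>w\<in>U j. form u w = 0))"

text \<open>The binary sum is the case of a family indexed by \<^typ>\<open>bool\<close>.\<close>

definition orthogonal_direct_sum2 :: "'b set \<Rightarrow> 'b set \<Rightarrow> 'b set \<Rightarrow> bool" where
  "orthogonal_direct_sum2 W U1 U2 \<longleftrightarrow>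
     orthogonal_direct_sum W UNIV (\<lambda>k::bool. if k then U1 else U2)"

definition associated_graph :: "('b \<Rightarrow> 'b) \<Rightarrow> 'b set \<Rightarrow> 'b pair_pre_digraph" where
  "associated_graph f B =
     \<lparr> pverts = B,
       parcs = {(b, c). b \<in> B \<and> c \<in> B \<and>
         (form b c \<noteq> 0 \<or> form c b \<noteq> 0 \<or> representation B (f b) c \<noteq> 0)} \<rparr>"

text \<open>Meaningful when \<open>C\<close> is a basis of \<open>U\<close> and \<open>U\<close> is invariant under \<open>g\<close>.\<close>

definition decomposable :: "('b \<Rightarrow> 'b) \<Rightarrow> 'b set \<Rightarrow> 'b set \<Rightarrow> bool" where
  "decomposable g C U \<longleftrightarrow>
     (\<exists>U1 U2. orthogonal_direct_sum2 U U1 U2 \<and> U1 \<noteq> {0} \<and> U2 \<noteq> {0} \<and>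
        admits_inherited_basis C U1 \<and> admits_inherited_basis C U2 \<and>
        g ` U1 \<subseteq> U1 \<and> g ` U2 \<subseteq> U2)"

abbreviation indecomposable :: "('b \<Rightarrow> 'b) \<Rightarrow> 'b set \<Rightarrow> 'b set \<Rightarrow> bool" where
  "indecomposable g C U \<equiv> \<not> decomposable g C U"

end

end

theory Submission
  imports Defs "HOL-Library.Disjoint_Sets"
begin

text \<open>The classes of the graph partition the basis, so \<open>V\<close> is the direct sum of the spans; no arc joins
  two classes, so the spans are mutually orthogonal and \<open>f\<close>-invariant, and \<open>f\<^sub>i\<close> is \<open>f\<close> composed with
  the projection onto \<open>U\<^sub>i\<close>.  Conversely, in a decomposition of \<open>U\<^sub>i\<close> with inherited bases
  \<open>C\<^sub>1\<close>, \<open>C\<^sub>2\<close>, these two sets partition the class without any arc between them, which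
  contradicts connectedness.\<close>

section \<open>Connectedness as reachability in the symmetrized digraph\<close>

text \<open>The disjunct \<open>v = w\<close> is absorbed because reachability is reflexive on
  vertices, so the calculus of \<open>reachable\<close> becomes available for
  \<open>connected_rel\<close>.\<close>

lemma (in pair_wf_digraph) connected_rel_eq:
  "connected_rel G = {(v, w). v \<rightarrow>\<^sup>*\<^bsub>mk_symmetric G\<^esub> w}"
proof -
  interpret S: pair_wf_digraph "mk_symmetric G" ..
  show ?thesis
    unfolding connected_rel_def undirected_path_def S.reachable_vwalk_conv[symmetric]
    using S.reachable_in_verts by auto
qed

lemma (in pair_wf_digraph) equiv_connected_rel: "equiv (pverts G) (connected_rel G)"
proof -
  interpret S: pair_wf_digraph "mk_symmetric G" ..
  show ?thesis
  proof (rule equivI)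
    show "connected_rel G \<subseteq> pverts G \<times> pverts G"
      by (auto simp: connected_rel_def)
    show "refl_on (pverts G) (connected_rel G)"
      by (auto simp: connected_rel_def refl_on_def)
    show "sym (connected_rel G)"
      unfolding connected_rel_eq
      by (auto intro!: symI elim: symmetric_reachable[OF symmetric_mk_symmetric])
    show "trans (connected_rel G)"
      unfolding connected_rel_eq by (auto intro!: transI elim: S.reachable_trans)
  qed
qed

lemma (in pair_wf_digraph) connected_class_trans:
  assumes "b \<in> connected_class G v" "(b, c) \<in> connected_rel G"
  shows "c \<in> connected_class G v"
  using assms equiv_connected_rel unfolding connected_class_def
  by (auto elim!: equivE dest: transD)

lemma (in pair_wf_digraph) parcs_subset_connected_rel: "parcs G \<subseteq> connected_rel G"
proof -
  interpret S: pair_wf_digraph "mk_symmetric G" ..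
  show ?thesis
    unfolding connected_rel_eq
    by (force simp: parcs_mk_symmetric intro!: S.reachable_adjI)
qed

text \<open>Induction along an undirected path. With \<open>X\<close> one half of a split class, it
  turns the absence of arcs between the halves into a contradiction.\<close>

lemma (in pair_wf_digraph) connected_rel_closed:
  assumes "(v, w) \<in> connected_rel G" and "v \<in> X"
    and step: "\<And>a b. a \<in> X \<Longrightarrow> (a, b) \<in> parcs G \<or> (b, a) \<in> parcs G \<Longrightarrow> b \<in> X"
  shows "w \<in> X"
proof -
  have "(v, w) \<in> rtrancl_on (pverts G) (parcs (mk_symmetric G))"
    using assms(1) by (simp add: connected_rel_eq reachable_def)
  then show ?thesis
    using \<open>v \<in> X\<close>
  proof (induction rule: rtrancl_on.induct)
    case (rtrancl_on_into_rtrancl_on a b)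
    then show ?case
      by (auto simp: parcs_mk_symmetric intro: step)
  qed
qed

section \<open>Linear algebra of a basis cut into blocks\<close>

context vector_space
begin

text \<open>A vector of \<open>span C\<close> has the same coordinates relative to \<open>C\<close>
  and to \<open>B\<close>, so they vanish off \<open>C\<close>. This is how invariance of a span
  becomes a statement about missing arcs.\<close>

lemma representation_span_subset:
  assumes "independent B" "C \<subseteq> B" "v \<in> span C" "representation B v b \<noteq> 0"
  shows "b \<in> C"
  using assms representation_extend[of B v C] representation_ne_zero[of C v b] by simp

lemma linear_image_span_subset:
  assumes "Vector_Spaces.linear scale scale f" "\<And>c. c \<in> C \<Longrightarrow> f c \<in> span D"
  shows "f ` span C \<subseteq> span D"
proof -
  interpret f: Vector_Spaces.linear scale scale f by fact
  have "f ` span C = span (f ` C)"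
    by (simp add: f.span_image)
  also have "\<dots> \<subseteq> span D"
    using assms(2) by (intro span_minimal) auto
  finally show ?thesis .
qed

text \<open>\<open>f\<close> commutes with the finite sum of the \<open>p i v\<close>. The support
  may shrink, since \<open>f\<close> can kill some \<open>p i v\<close>, but only zero terms are
  dropped.\<close>

lemma is_pointwise_sum_compose:
  assumes "Vector_Spaces.linear scale scale f" "is_pointwise_sum id I p"
  shows "is_pointwise_sum f I (\<lambda>i. f \<circ> p i)"
  unfolding is_pointwise_sum_def
proof (intro allI conjI)
  fix v
  interpret f: Vector_Spaces.linear scale scale f by fact
  have sub: "{i \<in> I. (f \<circ> p i) v \<noteq> 0} \<subseteq> {i \<in> I. p i v \<noteq> 0}"
    by auto
  have fin: "finite {i \<in> I. p i v \<noteq> 0}" and v: "v = (\<Sum>i | i \<in> I \<and> p i v \<noteq> 0. p i v)"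
    using assms(2) by (auto simp: is_pointwise_sum_def)
  show "finite {i \<in> I. (f \<circ> p i) v \<noteq> 0}"
    using sub fin by (rule finite_subset)
  have "f v = (\<Sum>i | i \<in> I \<and> p i v \<noteq> 0. f (p i v))"
    by (subst v) (rule f.sum)
  also have "\<dots> = (\<Sum>i | i \<in> I \<and> (f \<circ> p i) v \<noteq> 0. (f \<circ> p i) v)"
    using fin sub by (intro sum.mono_neutral_cong_right) auto
  finally show "f v = (\<Sum>i | i \<in> I \<and> (f \<circ> p i) v \<noteq> 0. (f \<circ> p i) v)" .
qed

text \<open>\<open>p i\<close> is the linear extension of the map that fixes the basis vectors in
  \<open>P i\<close> and kills the remaining ones; independence makes the extension possible, and
  disjointness makes \<open>p i\<close> vanish on every other block.\<close>

lemma partition_projections: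
  assumes ind: "independent (\<Union>i\<in>I. P i)" and span: "span (\<Union>i\<in>I. P i) = UNIV"
    and disj: "disjoint_family_on P I"
  obtains p where "\<And>i. Vector_Spaces.linear scale scale (p i)"
    and "\<And>i v. p i v \<in> span (P i)"
    and "\<And>i v. i \<in> I \<Longrightarrow> v \<in> span (P i) \<Longrightarrow> p i v = v"
    and "\<And>i j v. i \<in> I \<Longrightarrow> j \<in> I \<Longrightarrow> i \<noteq> j \<Longrightarrow> v \<in> span (P j) \<Longrightarrow> p i v = 0"
    and "is_pointwise_sum id I p"
proof -
  interpret pair: vector_space_pair scale scale ..
  define B where "B = (\<Union>i\<in>I. P i)"
  define p where "p i = pair.construct B (\<lambda>b. if b \<in> P i then b else 0)" for i
  have lin: "Vector_Spaces.linear scale scale (p i)" for i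
    using ind by (simp add: p_def B_def pair.linear_construct)
  have basis: "p i b = (if b \<in> P i then b else 0)" if "k \<in> I" "b \<in> P k" for i k b
    using ind that unfolding p_def B_def by (subst pair.construct_basis) auto
  have range: "p i v \<in> span (P i)" for i v
  proof -
    have "p i ` span B \<subseteq> span (P i)"
      using lin by (rule linear_image_span_subset) (auto simp: B_def basis span_base span_zero)
    then show ?thesis
      using span by (auto simp: B_def)
  qed
  have id: "p i v = v" if "i \<in> I" "v \<in> span (P i)" for i v
    using that(2)
    by (rule pair.linear_eq_on[OF lin linear_id[unfolded id_def]])
      (simp add: basis[OF \<open>i \<in> I\<close>])
  have zero: "p i v = 0" if "i \<in> I" "j \<in> I" "i \<noteq> j" "v \<in> span (P j)" for i j v
    using that(4)
    by (rule pair.linear_eq_on[OF lin pair.linear_zero])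
      (use that disj in \<open>auto simp: basis[OF \<open>j \<in> I\<close>] disjoint_family_on_def\<close>)
  have "finite {i \<in> I. p i v \<noteq> 0} \<and> v = (\<Sum>i | i \<in> I \<and> p i v \<noteq> 0. p i v)" for v
  proof -
    have "v \<in> span B"
      using span by (simp add: B_def)
    then show ?thesis
    proof (induction rule: span_induct_alt)
      case base
      have "p i 0 = 0" for i
        using pair.linear_0[OF lin] .
      then show ?case by simp
    next
      case (step c b w)
      then obtain k where k: "k \<in> I" "b \<in> P k"
        by (auto simp: B_def)
      \<comment> \<open>Adding a multiple of \<open>b\<close> changes only the component at
        \<open>k\<close>, which may appear or cancel. The finite set \<open>F\<close> contains the
        supports before and after, so both sums can be compared over it.\<close>
      define F where "F = insert k {i \<in> I. p i w \<noteq> 0}"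
      have fin: "finite F" and F: "F \<subseteq> I" "k \<in> F"
        using step k by (auto simp: F_def)
      have p: "p i (scale c b + w) = (if i = k then scale c b else 0) + p i w" if "i \<in> I" for i
      proof -
        interpret l: Vector_Spaces.linear scale scale "p i" by (rule lin)
        have "p i b = (if i = k then b else 0)"
          using that k id[OF k(1) span_base[OF k(2)]] zero[OF that k(1) _ span_base[OF k(2)]] by auto
        then show ?thesis
          by (auto simp: l.add l.scale)
      qed
      have sub: "{i \<in> I. p i (scale c b + w) \<noteq> 0} \<subseteq> F"
        by (auto simp: p F_def)
      have "w = (\<Sum>i\<in>F. p i w)"
        using fin F by (intro trans[OF conjunct2[OF step.IH] sum.mono_neutral_left]) (auto simp: F_def)
      then have "scale c b + w = (\<Sum>i\<in>F. (if i = k then scale c b else 0) + p i w)"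
        using fin F by (simp add: sum.distrib)
      also have "\<dots> = (\<Sum>i\<in>F. p i (scale c b + w))"
        using F by (intro sum.cong) (auto simp: p)
      also have "\<dots> = (\<Sum>i | i \<in> I \<and> p i (scale c b + w) \<noteq> 0. p i (scale c b + w))"
        using fin F sub by (intro sum.mono_neutral_right) auto
      finally show ?case
        using finite_subset[OF sub fin] by blast
    qed
  qed
  then have "is_pointwise_sum id I p"
    by (simp add: is_pointwise_sum_def)
  with lin range id zero show ?thesis
    by (rule that)
qed

end

context pre_euclidean_space
begin

text \<open>The vectors \<open>p i v\<close> give existence of a decomposition. For uniqueness,
  applying \<open>p k\<close> to any decomposition of \<open>v\<close> leaves only its component at
  \<open>k\<close>.\<close>

lemma direct_sumI_projections:
  assumes sub: "\<And>i. i \<in> I \<Longrightarrow> subspace (U i)"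
    and lin: "\<And>i. Vector_Spaces.linear scale scale (p i)"
    and range: "\<And>i v. i \<in> I \<Longrightarrow> p i v \<in> U i"
    and id: "\<And>i v. i \<in> I \<Longrightarrow> v \<in> U i \<Longrightarrow> p i v = v"
    and zero: "\<And>i j v. i \<in> I \<Longrightarrow> j \<in> I \<Longrightarrow> i \<noteq> j \<Longrightarrow> v \<in> U j \<Longrightarrow> p i v = 0"
    and sum: "is_pointwise_sum id I p"
  shows "direct_sum UNIV I U"
proof -
  \<comment> \<open>The value \<open>0\<close> outside \<open>I\<close> is what
    \<open>decomposes_as\<close> demands; there \<open>p i\<close> is only known to be
    linear.\<close>
  have dec: "decomposes_as I U v (\<lambda>i. if i \<in> I then p i v else 0)" for v
  proof -
    have "{i. (if i \<in> I then p i v else 0) \<noteq> 0} = {i \<in> I. p i v \<noteq> 0}"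
      by auto
    then show ?thesis
      using sum range by (auto simp: decomposes_as_def is_pointwise_sum_def)
  qed
  have uniq: "u = (\<lambda>i. if i \<in> I then p i v else 0)" if "decomposes_as I U v u" for v u
  proof
    fix k
    from that have u: "\<And>i. i \<in> I \<Longrightarrow> u i \<in> U i" "\<And>i. i \<notin> I \<Longrightarrow> u i = 0"
      and fin: "finite {i. u i \<noteq> 0}" and v: "v = (\<Sum>i | u i \<noteq> 0. u i)"
      by (auto simp: decomposes_as_def)
    show "u k = (if k \<in> I then p k v else 0)"
    proof (cases "k \<in> I")
      case True
      interpret l: Vector_Spaces.linear scale scale "p k" by (rule lin)
      have "p k v = (\<Sum>i | u i \<noteq> 0. p k (u i))"
        by (subst v) (rule l.sum)
      also have "\<dots> = (\<Sum>i | u i \<noteq> 0. if i = k then u k else 0)"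
      proof (rule sum.cong[OF refl])
        fix i assume "i \<in> {i. u i \<noteq> 0}"
        then have "i \<in> I"
          using u(2) by blast
        then show "p k (u i) = (if i = k then u k else 0)"
          using id[of k "u k"] zero[of k i "u i"] u(1) True by auto
      qed
      also have "\<dots> = u k"
        using fin by simp
      finally show ?thesis
        using True by simp
    qed (simp add: u)
  qed
  show ?thesis
    unfolding direct_sum_def subspace_sum_def
    using sub dec uniq by blast
qed

lemma form_eq_0_span:
  assumes "\<And>b c. b \<in> C \<Longrightarrow> c \<in> D \<Longrightarrow> form b c = 0" and "u \<in> span C" "w \<in> span D"
  shows "form u w = 0"
proof -
  have b: "form b w = 0" if "b \<in> C" for b
  proof -
    interpret l: Vector_Spaces.linear scale "(*)" "form b" by (rule linear_form_right)
    show ?thesis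
      using assms(1)[OF that] assms(3) by (rule l.eq_0_on_span)
  qed
  interpret l: Vector_Spaces.linear scale "(*)" "\<lambda>v. form v w" by (rule linear_form_left)
  show ?thesis
    using b assms(2) by (rule l.eq_0_on_span)
qed

text \<open>Reduces a decomposition into subspaces to combinatorics of the basis: the sum being all
  of \<open>U\<close> forces the inherited bases to cover \<open>C\<close>, and its directness
  forces them to be disjoint.\<close>

lemma decomposable_imp_basis_split:
  assumes C: "is_basis C U" and dec: "decomposable g C U"
  obtains C1 C2 where "C1 \<union> C2 = C" "C1 \<noteq> {}" "C2 \<noteq> {}"
    and "\<And>b c. b \<in> C1 \<Longrightarrow> c \<in> C2 \<Longrightarrow> form b c = 0 \<and> form c b = 0"
    and "C1 \<inter> C2 = {}"
    and "g ` span C1 \<subseteq> span C1" "g ` span C2 \<subseteq> span C2"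
proof -
  obtain U1 U2 where U12: "orthogonal_direct_sum2 U U1 U2" "U1 \<noteq> {0}" "U2 \<noteq> {0}"
      "admits_inherited_basis C U1" "admits_inherited_basis C U2" "g ` U1 \<subseteq> U1" "g ` U2 \<subseteq> U2"
    using dec unfolding decomposable_def by (elim exE conjE)
  obtain C1 where C1: "C1 \<subseteq> C" "span C1 = U1"
    using U12(4) unfolding admits_inherited_basis_def is_basis_def by (elim exE conjE)
  obtain C2 where C2: "C2 \<subseteq> C" "span C2 = U2"
    using U12(5) unfolding admits_inherited_basis_def is_basis_def by (elim exE conjE)
  have sum: "orthogonal_direct_sum2 U (span C1) (span C2)"
    and nz: "span C1 \<noteq> {0}" "span C2 \<noteq> {0}" and CC: "C1 \<subseteq> C" "C2 \<subseteq> C"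
    and g: "g ` span C1 \<subseteq> span C1" "g ` span C2 \<subseteq> span C2"
    using U12 C1 C2 by simp_all
  let ?W = "\<lambda>k::bool. if k then span C1 else span C2"
  have ds: "direct_sum U UNIV ?W"
    and orth: "\<And>k l u w. k \<noteq> l \<Longrightarrow> u \<in> ?W k \<Longrightarrow> w \<in> ?W l \<Longrightarrow> form u w = 0"
    using sum by (auto simp: orthogonal_direct_sum2_def orthogonal_direct_sum_def)
  have ind: "independent C" and U: "span C = U"
    using C by (auto simp: is_basis_def)
  \<comment> \<open>A vector \<open>x\<close> of \<open>C\<close> outside both sets would lie in the
    span of \<open>C - {x}\<close>, against independence.\<close>
  have "C \<subseteq> C1 \<union> C2"
  proof
    fix x assume x: "x \<in> C"
    then have "x \<in> subspace_sum UNIV ?W"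
      using ds U span_base unfolding direct_sum_def by blast
    then obtain u where u: "\<forall>k. u k \<in> ?W k" and x_eq: "x = (\<Sum>k | u k \<noteq> 0. u k)"
      unfolding subspace_sum_def decomposes_as_def by blast
    have W: "?W k \<subseteq> span (C1 \<union> C2)" for k
      using span_mono[of C1 "C1 \<union> C2"] span_mono[of C2 "C1 \<union> C2"] by (cases k) auto
    have "x \<in> span (C1 \<union> C2)"
      unfolding x_eq
    proof (rule span_sum)
      fix k show "u k \<in> span (C1 \<union> C2)"
        using W[of k] u[rule_format, of k] by (rule subsetD)
    qed
    moreover have "C1 \<union> C2 \<subseteq> C - {x}" if "x \<notin> C1 \<union> C2"
      using that CC by auto
    ultimately show "x \<in> C1 \<union> C2"
      using ind x span_mono unfolding dependent_def by blast
  qed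
  moreover have "C1 \<inter> C2 = {}"
  proof (rule ccontr)
    assume "C1 \<inter> C2 \<noteq> {}"
    then obtain b where b: "b \<in> C1" "b \<in> C2"
      by blast
    then have "b \<noteq> 0" "b \<in> U"
      using ind CC U dependent_zero span_base by blast+
    \<comment> \<open>A shared \<open>b\<close> may be placed in either summand, as \<open>l\<close>
      selects; since \<open>b\<close> is non-zero, this yields two different decompositions.\<close>
    have "decomposes_as UNIV ?W b (\<lambda>k. if k = l then b else 0)" for l
    proof -
      have "{k. (if k = l then b else 0) \<noteq> 0} = {l}"
        using \<open>b \<noteq> 0\<close> by auto
      then show ?thesis
        using b by (simp add: decomposes_as_def span_base span_zero)
    qed
    then have "(\<lambda>k. if k = True then b else 0) = (\<lambda>k. if k = False then b else 0)"
      using ds \<open>b \<in> U\<close> unfolding direct_sum_def by blast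
    then show False
      using \<open>b \<noteq> 0\<close> by (auto dest: fun_cong[of _ _ True])
  qed
  moreover have "form b c = 0 \<and> form c b = 0" if "b \<in> C1" "c \<in> C2" for b c
    using that orth[of True False b c] orth[of False True c b] by (simp add: span_base)
  moreover have "C1 \<noteq> {}" "C2 \<noteq> {}"
    using nz by auto
  ultimately show ?thesis
    using CC g by (intro that[of C1 C2]) auto
qed

section \<open>Classes of the associated graph: invariance and indecomposability\<close>

lemma pair_wf_digraph_associated_graph: "pair_wf_digraph (associated_graph f B)"
  by unfold_locales (auto simp: associated_graph_def)

text \<open>Every basis vector with non-zero coefficient in \<open>f c\<close> is the head of an arc
  from \<open>c\<close>, hence stays in the class of \<open>c\<close>.\<close>

lemma span_connected_class_invariant:
  assumes lin: "Vector_Spaces.linear scale scale f" and B: "is_basis B UNIV"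
  shows "f ` span (connected_class (associated_graph f B) b)
    \<subseteq> span (connected_class (associated_graph f B) b)"
  using lin
proof (rule linear_image_span_subset)
  let ?G = "associated_graph f B"
  interpret G: pair_wf_digraph ?G by (rule pair_wf_digraph_associated_graph)
  fix c assume c: "c \<in> connected_class ?G b"
  then have "c \<in> B"
    by (auto simp: connected_class_def associated_graph_def connected_rel_def)
  have "d \<in> connected_class ?G b" if "representation B (f c) d \<noteq> 0" for d
  proof -
    have "(c, d) \<in> parcs ?G"
      using that \<open>c \<in> B\<close> by (auto simp: associated_graph_def intro: representation_ne_zero)
    then have "(c, d) \<in> connected_rel ?G"
      using G.parcs_subset_connected_rel by blast
    with c show ?thesis
      by (rule G.connected_class_trans)
  qed
  then have "(\<Sum>d | representation B (f c) d \<noteq> 0. scale (representation B (f c) d) d)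
      \<in> span (connected_class ?G b)"
    by (intro span_sum span_scale span_base) auto
  then show "f c \<in> span (connected_class ?G b)"
    using B sum_nonzero_representation_eq[of B "f c"] by (simp add: is_basis_def)
qed

text \<open>The graph is built from \<open>f\<close>, but only the values of \<open>f\<close> on
  \<open>U\<close> matter for the class, so the argument carries over to any \<open>g\<close>
  agreeing with \<open>f\<close> there, in particular to \<open>f\<close> after a
  projection.\<close>

lemma indecomposable_connected_class:
  assumes B: "is_basis B UNIV"
    and C: "is_basis (connected_class (associated_graph f B) b) U"
    and g: "\<And>u. u \<in> U \<Longrightarrow> g u = f u"
  shows "indecomposable g (connected_class (associated_graph f B) b) U"
proof
  let ?G = "associated_graph f B"
  interpret G: pair_wf_digraph ?G by (rule pair_wf_digraph_associated_graph)
  assume "decomposable g (connected_class ?G b) U"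
  with C obtain C1 C2 where CC: "C1 \<union> C2 = connected_class ?G b" "C1 \<noteq> {}" "C2 \<noteq> {}"
    and form: "\<And>b c. b \<in> C1 \<Longrightarrow> c \<in> C2 \<Longrightarrow> form b c = 0 \<and> form c b = 0"
    and disj: "C1 \<inter> C2 = {}"
    and inv: "g ` span C1 \<subseteq> span C1" "g ` span C2 \<subseteq> span C2"
    by (rule decomposable_imp_basis_split) blast
  have CB: "connected_class ?G b \<subseteq> B"
    by (auto simp: connected_class_def connected_rel_def associated_graph_def)
  \<comment> \<open>Kept general in \<open>D\<close> so as to serve both \<open>C1\<close> and
    \<open>C2\<close>.\<close>
  have no_coeff: "representation B (f x) y = 0"
    if "D \<subseteq> connected_class ?G b" "g ` span D \<subseteq> span D" "x \<in> D" "y \<notin> D" for D x y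
  proof -
    have "x \<in> U"
      using C that span_base unfolding is_basis_def by blast
    then have "f x \<in> span D"
      using g[of x] that span_base[of x D] by auto
    then show ?thesis
      using representation_span_subset[of B D "f x" y] B CB that by (auto simp: is_basis_def)
  qed
  obtain b1 b2 where b: "b1 \<in> C1" "b2 \<in> C2"
    using CC by auto
  have "(b, b1) \<in> connected_rel ?G" "(b, b2) \<in> connected_rel ?G"
    using b CC by (auto simp: connected_class_def)
  then have "(b1, b2) \<in> connected_rel ?G"
    using G.equiv_connected_rel by (meson equivE symD transD)
  then have "b2 \<in> C1"
  proof (rule G.connected_rel_closed[OF _ b(1)])
    fix x y assume x: "x \<in> C1" and xy: "(x, y) \<in> parcs ?G \<or> (y, x) \<in> parcs ?G"
    have "x \<in> connected_class ?G b"
      using x CC by auto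
    moreover have "(x, y) \<in> connected_rel ?G"
      using xy G.parcs_subset_connected_rel G.equiv_connected_rel by (meson equivE symD subsetD)
    ultimately have "y \<in> C1 \<union> C2"
      using G.connected_class_trans CC(1) by blast
    moreover have False if "y \<in> C2"
    proof -
      \<comment> \<open>The arc may point either way, so both coefficients have to vanish;
        \<open>form\<close> already excludes both orders of the bilinear form.\<close>
      have "x \<notin> C2" "y \<notin> C1"
        using that x disj by auto
      then have "representation B (f x) y = 0" "representation B (f y) x = 0"
        using no_coeff[of C1 x y] no_coeff[of C2 y x] CC(1) inv x that by auto
      then show False
        using xy form[OF x that] by (auto simp: associated_graph_def)
    qed
    ultimately show "y \<in> C1" by blast
  qed
  then show False
    using b disj by auto
qed

end

section \<open>Assembly of the decomposition and of the operators \<open>fi\<close>\<close>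

theorem theorem3p2:
  fixes scale :: "'a::field \<Rightarrow> 'b::ab_group_add \<Rightarrow> 'b"
    and form :: "'b \<Rightarrow> 'b \<Rightarrow> 'a"
    and f :: "'b \<Rightarrow> 'b"
    and e :: "'j \<Rightarrow> 'b"
    and I J :: "'j set"
    and G :: "'b pair_pre_digraph"
    and Bc :: "'j \<Rightarrow> 'b set"
    and U :: "'j \<Rightarrow> 'b set"
  assumes space: "pre_euclidean_space scale form"
    and lin: "Vector_Spaces.linear scale scale f"
    and inj: "inj_on e J"
    and basis: "pre_euclidean_space.is_basis scale (e ` J) UNIV"
    and graph: "G = pre_euclidean_space.associated_graph scale form f (e ` J)"
    and sub: "I \<subseteq> J"
    and reps: "bij_betw (\<lambda>i. connected_class G (e i)) I (pverts G // connected_rel G)"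
    and Bc: "\<And>i. i \<in> I \<Longrightarrow> Bc i = {e j | j. j \<in> J \<and> e j \<in> connected_class G (e i)}"
    and U: "\<And>i. i \<in> I \<Longrightarrow> pre_euclidean_space.is_basis scale (Bc i) (U i)"
  shows "pre_euclidean_space.orthogonal_direct_sum scale form UNIV I U \<and>
    (\<exists>fi :: 'j \<Rightarrow> 'b \<Rightarrow> 'b.
       (\<forall>i\<in>I. Vector_Spaces.linear scale scale (fi i)) \<and>
       is_pointwise_sum f I fi \<and>
       (\<forall>i\<in>I. (\<forall>u\<in>U i. fi i u = f u) \<and>
               fi i ` U i \<subseteq> U i \<and>
               fi i ` subspace_sum (I - {i}) U = {0} \<and>
               pre_euclidean_space.indecomposable scale form (fi i) (Bc i) (U i)))"
proof -
  interpret pre_euclidean_space scale form by (rule space)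
  let ?B = "e ` J"
  interpret G: pair_wf_digraph G
    unfolding graph by (rule pair_wf_digraph_associated_graph)
  have verts: "pverts G = ?B"
    by (simp add: graph associated_graph_def)
  have cls: "connected_class G b \<subseteq> ?B" for b
    using verts by (auto simp: connected_class_def connected_rel_def)
  have Bc_eq: "Bc i = connected_class G (e i)" if "i \<in> I" for i
    using Bc[OF that] cls[of "e i"] by auto
  have Ui: "U i = span (Bc i)" if "i \<in> I" for i
    using U[OF that] by (simp add: is_basis_def)
  have cover: "(\<Union>i\<in>I. Bc i) = ?B"
  proof -
    have "(\<Union>i\<in>I. Bc i) = \<Union> ((\<lambda>i. connected_class G (e i)) ` I)"
      using Bc_eq by simp
    also have "\<dots> = \<Union> (pverts G // connected_rel G)"
      using reps by (simp add: bij_betw_def)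
    finally show ?thesis
      using Union_quotient[OF G.equiv_connected_rel] verts by simp
  qed
  have disj: "disjoint_family_on Bc I"
    unfolding disjoint_family_on_def
  proof (intro ballI impI)
    \<comment> \<open>Injectivity in \<open>reps\<close> makes the classes distinct, and distinct
      classes of an equivalence relation are disjoint.\<close>
    fix i j assume ij: "i \<in> I" "j \<in> I" "i \<noteq> j"
    have "connected_class G (e i) \<noteq> connected_class G (e j)"
      using ij reps by (auto simp: bij_betw_def inj_on_def)
    moreover have "connected_class G (e k) \<in> pverts G // connected_rel G" if "k \<in> I" for k
      using that reps by (auto simp: bij_betw_def)
    ultimately show "Bc i \<inter> Bc j = {}"
      using quotient_disj[OF G.equiv_connected_rel] ij Bc_eq by metis
  qed
  have ind: "independent ?B" and sp: "span ?B = UNIV"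
    using basis by (auto simp: is_basis_def)
  obtain p where p: "\<And>i. Vector_Spaces.linear scale scale (p i)"
    "\<And>i v. p i v \<in> span (Bc i)"
    "\<And>i v. i \<in> I \<Longrightarrow> v \<in> span (Bc i) \<Longrightarrow> p i v = v"
    "\<And>i j v. i \<in> I \<Longrightarrow> j \<in> I \<Longrightarrow> i \<noteq> j \<Longrightarrow> v \<in> span (Bc j) \<Longrightarrow> p i v = 0"
    "is_pointwise_sum id I p"
    using partition_projections[of Bc I, unfolded cover, OF ind sp disj] by blast
  have direct: "direct_sum UNIV I U"
    by (rule direct_sumI_projections[of I U p]) (use p Ui in auto)
  \<comment> \<open>By bilinearity it suffices to test basis vectors, where a non-zero value would
    be an arc joining two different classes.\<close>
  have orth: "form u w = 0" if ij: "i \<in> I" "j \<in> I" "i \<noteq> j" and uw: "u \<in> U i" "w \<in> U j" for i j u w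
  proof (rule form_eq_0_span)
    show "u \<in> span (Bc i)" "w \<in> span (Bc j)"
      using ij uw Ui by auto
    fix b c assume b: "b \<in> Bc i" and c: "c \<in> Bc j"
    show "form b c = 0"
    proof (rule ccontr)
      assume "form b c \<noteq> 0"
      then have "(b, c) \<in> parcs G"
        using b c cover ij by (auto simp: graph associated_graph_def)
      then have "(b, c) \<in> connected_rel G"
        using G.parcs_subset_connected_rel by blast
      moreover have "b \<in> connected_class G (e i)"
        using b Bc_eq ij by simp
      ultimately have "c \<in> Bc i"
        using G.connected_class_trans Bc_eq[OF ij(1)] by blast
      then show False
        using c disj ij by (auto simp: disjoint_family_on_def)
    qed
  qed
  define fi where "fi i = f \<circ> p i" for i
  have fi_lin: "Vector_Spaces.linear scale scale (fi i)" for i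
    unfolding fi_def using p(1) lin by (rule Vector_Spaces.linear_compose)
  have fi_U: "fi i u = f u" if "i \<in> I" "u \<in> U i" for i u
    using that p(3) Ui by (simp add: fi_def)
  have f_U: "f ` U i \<subseteq> U i" if "i \<in> I" for i
    using span_connected_class_invariant[OF lin basis, of "e i"] that Ui Bc_eq graph by simp
  have fi_zero: "fi i ` subspace_sum (I - {i}) U = {0}" if "i \<in> I" for i
  proof -
    interpret l: Vector_Spaces.linear scale scale "fi i" by (rule fi_lin)
    have "fi i v = 0" if v: "v \<in> subspace_sum (I - {i}) U" for v
    proof -
      from v obtain u where u: "\<And>k. k \<in> I - {i} \<Longrightarrow> u k \<in> U k" "\<And>k. k \<notin> I - {i} \<Longrightarrow> u k = 0"
        and v: "v = (\<Sum>k | u k \<noteq> 0. u k)"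
        unfolding subspace_sum_def decomposes_as_def by blast
      interpret f: Vector_Spaces.linear scale scale f by (rule lin)
      \<comment> \<open>For \<open>k\<close> in \<open>I - {i}\<close> the projection
        \<open>p i\<close> kills \<open>u k\<close>; for all other \<open>k\<close>, including
        \<open>i\<close> itself, \<open>u k\<close> is the default \<open>0\<close>.\<close>
      have "fi i (u k) = 0" for k
        using u[of k] p(4)[of i k "u k"] \<open>i \<in> I\<close> Ui[of k] l.zero f.zero
        by (cases "k \<in> I - {i}") (auto simp: fi_def)
      then show ?thesis
        by (simp add: v l.sum)
    qed
    \<comment> \<open>The image equals \<open>{0}\<close>, rather than merely lying in it, because
      the sum is non-empty: the zero family decomposes \<open>0\<close>, even when
      \<open>I - {i}\<close> is empty.\<close>
    moreover have "0 \<in> subspace_sum (I - {i}) U"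
      unfolding subspace_sum_def decomposes_as_def
      by (auto intro!: exI[of _ "\<lambda>_. 0"] simp: Ui span_zero)
    ultimately show ?thesis
      by (auto simp: image_iff intro: bexI[of _ 0])
  qed
  have "indecomposable (fi i) (Bc i) (U i)" if "i \<in> I" for i
    using indecomposable_connected_class[OF basis, of f "e i" "U i" "fi i"] U[OF that] fi_U that
      Bc_eq graph by simp
  moreover have "is_pointwise_sum f I fi"
    unfolding fi_def using is_pointwise_sum_compose[OF lin p(5)] .
  ultimately show ?thesis
    using direct orth fi_lin fi_U f_U fi_zero
    unfolding orthogonal_direct_sum_def by (intro conjI exI[of _ fi]) (auto simp: image_subset_iff)
qed

end
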